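(* Let $A,B\in\mathbb{C}^{m\times n}$ with $\operatorname{rank}(A)=r\ge 1$ and $\operatorname{rank}(B)=s\ge 1$, and let $E=B-A$ and $\widetilde{E}=B^{\dagger}-A^{\dagger}$. Define \[ \beta'_{1}:=\max\bigg\{\frac{\|E\|_{F}^{2}-\|AA^{\dagger}E\|_{F}^{2}}{\|B\|_{2}^{2}},\frac{\|\widetilde{E}\|_{F}^{2}-\|\widetilde{E}AA^{\dagger}\|_{F}^{2}}{\|B^{\dagger}\|_{2}^{2}}\bigg\}, \] \[ \beta'_{2}:=\max\bigg\{\frac{\|E\|_{F}^{2}-\|BB^{\dagger}E\|_{F}^{2}}{\|A\|_{2}^{2}},\frac{\|\widetilde{E}\|_{F}^{2}-\|\widetilde{E}BB^{\dagger}\|_{F}^{2}}{\|A^{\dagger}\|_{2}^{2}}\bigg\}. \] Then \[ \|P_{B}-P_{A}\|_{F}^{2}\geq\beta'_{1}+\beta'_{2}. \] In particular, if $s=r$, then \[ \|P_{B}-P_{A}\|_{F}^{2}\geq 2\max\{\beta'_{1},\beta'_{2}\}. \]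
   Context: For a complex matrix $M$: $M^{\dagger}$ is the Moore--Penrose inverse, $\|M\|_{F}$ the Frobenius norm, $\|M\|_{2}$ the spectral norm, and $P_{M}=MM^{\dagger}$ the orthogonal projection onto the column space of $M$. *)

theory Defs
  imports "HOL-Analysis.Analysis"
begin

definition conj_transpose :: "complex^'n^'m \<Rightarrow> complex^'m^'n" where
  "conj_transpose M = (\<chi> i j. cnj (M $ j $ i))"

text \<open>The four Penrose conditions, which characterise the Moore--Penrose inverse uniquely.\<close>

definition is_mp_inverse :: "complex^'n^'m \<Rightarrow> complex^'m^'n \<Rightarrow> bool" where
  "is_mp_inverse M X \<longleftrightarrow>
     M ** X ** M = M \<and>
     X ** M ** X = X \<and>
     conj_transpose (M ** X) = M ** X \<and>
     conj_transpose (X ** M) = X ** M"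

definition mp_inverse :: "complex^'n^'m \<Rightarrow> complex^'m^'n" where
  "mp_inverse M = (THE X. is_mp_inverse M X)"

definition range_proj :: "complex^'n^'m \<Rightarrow> complex^'m^'m" where
  "range_proj M = M ** mp_inverse M"

definition frobenius_norm :: "complex^'n^'m \<Rightarrow> real" where
  "frobenius_norm M = sqrt (\<Sum>i\<in>UNIV. \<Sum>j\<in>UNIV. (cmod (M $ i $ j))\<^sup>2)"

lemma frobenius_norm_eq_norm: "frobenius_norm M = norm M"
  by (simp add: frobenius_norm_def norm_vec_def L2_set_def sum_nonneg)

text \<open>The norm on \<^typ>\<open>complex^'n\<close> is the Euclidean one, so this is the largest singular value.\<close>

definition spectral_norm :: "complex^'n^'m \<Rightarrow> real" where
  "spectral_norm M = onorm (\<lambda>x. M *v x)"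

definition beta1 :: "complex^'n^'m \<Rightarrow> complex^'n^'m \<Rightarrow> real" where
  "beta1 A B =
     (let E = B - A; E' = mp_inverse B - mp_inverse A in
      max (((frobenius_norm E)\<^sup>2 - (frobenius_norm (A ** mp_inverse A ** E))\<^sup>2)
             / (spectral_norm B)\<^sup>2)
          (((frobenius_norm E')\<^sup>2 - (frobenius_norm (E' ** A ** mp_inverse A))\<^sup>2)
             / (spectral_norm (mp_inverse B))\<^sup>2))"

definition beta2 :: "complex^'n^'m \<Rightarrow> complex^'n^'m \<Rightarrow> real" where
  "beta2 A B =
     (let E = B - A; E' = mp_inverse B - mp_inverse A in
      max (((frobenius_norm E)\<^sup>2 - (frobenius_norm (B ** mp_inverse B ** E))\<^sup>2)
             / (spectral_norm A)\<^sup>2)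
          (((frobenius_norm E')\<^sup>2 - (frobenius_norm (E' ** B ** mp_inverse B))\<^sup>2)
             / (spectral_norm (mp_inverse A))\<^sup>2))"

end

theory Submission
  imports Defs
begin

text \<open>
  Write \<open>P = A A\<^sup>\<dagger>\<close> and \<open>Q = B B\<^sup>\<dagger>\<close>. Since \<open>P A = A\<close> and \<open>Q B = B\<close>, one has
  \<open>(1 - P) E = (1 - P) Q B\<close>, and since \<open>A\<^sup>\<dagger> P = A\<^sup>\<dagger>\<close> and \<open>B\<^sup>\<dagger> Q = B\<^sup>\<dagger>\<close>, also
  \<open>E' (1 - P) = B\<^sup>\<dagger> Q (1 - P)\<close>. By Pythagoras, both entries of the maximum defining the first
  \<open>\<beta>\<close> are therefore at most \<open>\<parallel>Q - Q P\<parallel>\<^sup>2\<close>, and symmetrically the second \<open>\<beta>\<close> is at most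
  \<open>\<parallel>P - P Q\<parallel>\<^sup>2\<close>. These two numbers add up to \<open>\<parallel>Q - P\<parallel>\<^sup>2\<close>. Their difference is
  \<open>tr Q - tr P\<close>, which vanishes if the ranks agree.
\<close>

section \<open>Conjugate transpose and Frobenius inner product\<close>

lemma conj_transpose_conj_transpose [simp]: "conj_transpose (conj_transpose M) = M"
  by (simp add: conj_transpose_def vec_eq_iff)

lemma conj_transpose_mul: "conj_transpose (M ** N) = conj_transpose N ** conj_transpose M"
  by (simp add: conj_transpose_def vec_eq_iff matrix_matrix_mult_def mult.commute)

lemma conj_transpose_diff: "conj_transpose (M - N) = conj_transpose M - conj_transpose N"
  by (simp add: conj_transpose_def vec_eq_iff)

text \<open>On complex vectors \<open>\<bullet>\<close> is the real part of the Hermitian product.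
  The conjugate transpose is the adjoint for this real form as well.\<close>

lemma inner_matrix_vector_mult:
  fixes M :: "complex^'n^'m"
  shows "(M *v x) \<bullet> y = x \<bullet> (conj_transpose M *v y)"
proof -
  have "(M *v x) \<bullet> y = (\<Sum>i\<in>UNIV. \<Sum>j\<in>UNIV. (M $ i $ j * x $ j) \<bullet> y $ i)"
    by (simp add: inner_vec_def matrix_vector_mult_def inner_sum_left)
  also have "\<dots> = (\<Sum>i\<in>UNIV. \<Sum>j\<in>UNIV. x $ j \<bullet> (cnj (M $ i $ j) * y $ i))"
    by (simp add: inner_complex_def algebra_simps)
  also have "\<dots> = (\<Sum>j\<in>UNIV. \<Sum>i\<in>UNIV. x $ j \<bullet> (cnj (M $ i $ j) * y $ i))"
    by (rule sum.swap)
  also have "\<dots> = x \<bullet> (conj_transpose M *v y)"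
    by (simp add: inner_vec_def matrix_vector_mult_def conj_transpose_def inner_sum_right)
  finally show ?thesis .
qed

lemma column_matrix_mult: "column j (M ** N) = M *v column j N"
  by (simp add: column_def matrix_matrix_mult_def matrix_vector_mult_def vec_eq_iff)

lemma matrix_vector_mult_axis: "M *v axis j 1 = column j M"
  by (simp add: matrix_vector_mult_def column_def axis_def vec_eq_iff if_distrib cong: if_cong)

lemma inner_matrix_columns:
  fixes M N :: "complex^'n^'m"
  shows "M \<bullet> N = (\<Sum>j\<in>UNIV. column j M \<bullet> column j N)"
  unfolding inner_vec_def column_def by (subst sum.swap) simp

lemma inner_matrix_mult_left:
  fixes M :: "complex^'n^'m"
  shows "(M ** X) \<bullet> Y = X \<bullet> (conj_transpose M ** Y)"
  by (simp add: inner_matrix_columns column_matrix_mult inner_matrix_vector_mult)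

lemma inner_conj_transpose: "conj_transpose X \<bullet> conj_transpose Y = X \<bullet> Y"
  unfolding inner_vec_def conj_transpose_def
  by (subst sum.swap) (simp add: inner_complex_def)

lemma norm_conj_transpose: "norm (conj_transpose X) = norm X"
  by (simp add: norm_eq_sqrt_inner inner_conj_transpose)

lemma inner_matrix_mult_right: "(X ** M) \<bullet> Y = X \<bullet> (Y ** conj_transpose M)"
proof -
  have "(X ** M) \<bullet> Y = (conj_transpose M ** conj_transpose X) \<bullet> conj_transpose Y"
    by (simp add: conj_transpose_mul[symmetric] inner_conj_transpose)
  also have "\<dots> = conj_transpose X \<bullet> conj_transpose (Y ** conj_transpose M)"
    by (simp add: inner_matrix_mult_left conj_transpose_mul)
  finally show ?thesis
    by (simp add: inner_conj_transpose)
qed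

text \<open>Links the inner product to the trace; this later makes the squared norm of a projection
  its trace.\<close>

lemma inner_mat_1: "mat 1 \<bullet> X = Re (trace X)"
proof -
  have "mat 1 $ i $ j \<bullet> X $ i $ j = (if i = j then Re (X $ i $ j) else 0)" for i j
    by (simp add: mat_def inner_complex_def)
  then show ?thesis
    by (simp add: inner_vec_def trace_def)
qed

lemma matrix_diff_ldistrib:
  fixes A :: "'a::ring_1^'n^'m"
  shows "A ** (B - C) = A ** B - A ** C"
  by (simp add: matrix_matrix_mult_def vec_eq_iff right_diff_distrib sum_subtractf)

lemma matrix_diff_rdistrib:
  fixes A :: "'a::ring_1^'n^'m"
  shows "(A - B) ** C = A ** C - B ** C"
  by (simp add: matrix_matrix_mult_def vec_eq_iff left_diff_distrib sum_subtractf)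

lemma matrix_minus_right:
  fixes A :: "'a::ring_1^'n^'m"
  shows "A ** (- B) = - (A ** B)"
  using matrix_diff_ldistrib[of A 0 B] by simp

lemma matrix_minus_left:
  fixes A :: "'a::ring_1^'n^'m"
  shows "(- A) ** B = - (A ** B)"
  using matrix_diff_rdistrib[of 0 A B] by simp

section \<open>Frobenius and spectral norm\<close>

lemma bounded_linear_matrix_vector_mult: "bounded_linear (\<lambda>x. (M :: complex^'n^'m) *v x)"
  by (simp add: linear_conv_bounded_linear[symmetric])

lemma spectral_norm_nonneg: "0 \<le> spectral_norm M"
  unfolding spectral_norm_def by (rule onorm_pos_le[OF bounded_linear_matrix_vector_mult])

lemma norm_matrix_vector_mult_le: "norm (M *v x) \<le> spectral_norm M * norm x"
  unfolding spectral_norm_def by (rule onorm[OF bounded_linear_matrix_vector_mult])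

lemma norm_matrix_mult_le_left:
  "(norm (M ** N))\<^sup>2 \<le> (norm N)\<^sup>2 * (spectral_norm M)\<^sup>2"
proof -
  have "(norm (M ** N))\<^sup>2 = (\<Sum>j\<in>UNIV. (norm (M *v column j N))\<^sup>2)"
    by (simp add: power2_norm_eq_inner inner_matrix_columns column_matrix_mult)
  also have "\<dots> \<le> (\<Sum>j\<in>UNIV. (spectral_norm M * norm (column j N))\<^sup>2)"
    by (intro sum_mono power_mono norm_matrix_vector_mult_le norm_ge_zero)
  also have "\<dots> = (norm N)\<^sup>2 * (spectral_norm M)\<^sup>2"
    by (simp add: power2_norm_eq_inner[of N] inner_matrix_columns power_mult_distrib
        sum_distrib_left mult.commute power2_norm_eq_inner[symmetric])
  finally show ?thesis .
qed

text \<open>With \<open>y\<close> the image of \<open>x\<close> under the adjoint,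
  \<open>(norm y)\<^sup>2\<close> is the inner product of \<open>M *v y\<close> with
  \<open>x\<close>; Cauchy-Schwarz and cancelling \<open>norm y\<close> give the bound.\<close>

lemma spectral_norm_conj_transpose_le: "spectral_norm (conj_transpose M) \<le> spectral_norm M"
  unfolding spectral_norm_def[of "conj_transpose M"]
proof (rule onorm_bound[OF spectral_norm_nonneg])
  fix x
  let ?y = "conj_transpose M *v x"
  have "(norm ?y)\<^sup>2 = (M *v ?y) \<bullet> x"
    by (simp add: power2_norm_eq_inner inner_matrix_vector_mult)
  also have "\<dots> \<le> norm (M *v ?y) * norm x"
    by (rule norm_cauchy_schwarz)
  also have "\<dots> \<le> (spectral_norm M * norm ?y) * norm x"
    by (intro mult_right_mono norm_matrix_vector_mult_le norm_ge_zero)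
  finally have "norm ?y * norm ?y \<le> (spectral_norm M * norm x) * norm ?y"
    by (simp add: power2_eq_square mult_ac)
  then show "norm ?y \<le> spectral_norm M * norm x"
    by (cases "norm ?y = 0") (auto simp: spectral_norm_nonneg)
qed

lemma norm_matrix_mult_le_right:
  "(norm (N ** M))\<^sup>2 \<le> (norm N)\<^sup>2 * (spectral_norm M)\<^sup>2"
proof -
  have "(norm (N ** M))\<^sup>2 = (norm (conj_transpose M ** conj_transpose N))\<^sup>2"
    by (metis conj_transpose_mul norm_conj_transpose)
  also have "\<dots> \<le> (norm N)\<^sup>2 * (spectral_norm (conj_transpose M))\<^sup>2"
    using norm_matrix_mult_le_left[of "conj_transpose M" "conj_transpose N"]
    by (simp add: norm_conj_transpose)
  also have "\<dots> \<le> (norm N)\<^sup>2 * (spectral_norm M)\<^sup>2"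
    by (intro mult_left_mono power_mono spectral_norm_conj_transpose_le spectral_norm_nonneg) simp
  finally show ?thesis .
qed

section \<open>The Moore--Penrose inverse\<close>

text \<open>Split each \<open>b\<close> orthogonally along the range of \<open>M\<close>: the
  adjoint kills the normal part, and the other part has the form \<open>M *v x\<close>. Solving for
  every basis vector gives the columns of \<open>X\<close>.\<close>

lemma normal_equations_solvable:
  "\<exists>X. conj_transpose M ** M ** X = conj_transpose (M :: complex^'n^'m)"
proof -
  have "\<exists>x. conj_transpose M *v (M *v x) = conj_transpose M *v b" for b
  proof -
    have sp: "span (range ((*v) M)) = range ((*v) M)"
      by (rule span_eq_iff[THEN iffD2]) (intro linear_subspace_image matrix_vector_mul_linear subspace_UNIV)
    obtain y z where y: "y \<in> range ((*v) M)"
      and z: "\<And>w. w \<in> range ((*v) M) \<Longrightarrow> orthogonal z w" and b: "b = y + z"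
      using orthogonal_subspace_decomp_exists[of "range ((*v) M)" b] unfolding sp by metis
    have "w \<bullet> (conj_transpose M *v z) = 0" for w
      using z[of "M *v w"]
      by (simp add: inner_matrix_vector_mult[symmetric] orthogonal_def inner_commute)
    then have "conj_transpose M *v z = 0"
      by (metis inner_eq_zero_iff)
    with y b show ?thesis
      by (auto simp: matrix_vector_right_distrib)
  qed
  then obtain f where f: "\<And>b. conj_transpose M *v (M *v f b) = conj_transpose M *v b"
    by metis
  define X :: "complex^'m^'n" where "X = (\<chi> i j. f (axis j 1) $ i)"
  have colX: "column j X = f (axis j 1)" for j
    by (simp add: column_def X_def vec_eq_iff)
  have "column j (conj_transpose M ** M ** X) = column j (conj_transpose M)" for j
    by (simp add: column_matrix_mult colX matrix_vector_mul_assoc[symmetric] f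
        matrix_vector_mult_axis)
  then have "conj_transpose M ** M ** X = conj_transpose M"
    by (simp add: column_def vec_eq_iff)
  then show ?thesis ..
qed

text \<open>For a solution \<open>X\<close> of the normal equations, \<open>M ** X\<close> equals
  its own adjoint times itself, hence is Hermitian.\<close>

lemma least_squares_inverse_exists:
  "\<exists>X. M ** X ** M = M \<and> conj_transpose (M ** X) = M ** (X :: complex^'m^'n)"
proof -
  obtain X where X: "conj_transpose M ** M ** X = conj_transpose M"
    using normal_equations_solvable by blast
  have X': "conj_transpose X ** conj_transpose M ** M = M"
    using arg_cong[OF X, of conj_transpose] by (simp add: conj_transpose_mul matrix_mul_assoc)
  then have "conj_transpose (M ** X) ** (M ** X) = M ** X"
    by (simp add: conj_transpose_mul matrix_mul_assoc)
  then have herm: "conj_transpose (M ** X) = M ** X"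
    by (metis conj_transpose_conj_transpose conj_transpose_mul)
  moreover have "M ** X ** M = M"
    using X' herm by (simp add: conj_transpose_mul)
  ultimately show ?thesis by blast
qed

text \<open>Two partial inverses are combined: \<open>X\<close> makes \<open>M ** X\<close>
  Hermitian, and \<open>Y\<close>, the adjoint of such an inverse of the adjoint, makes
  \<open>Y ** M\<close> Hermitian. The product \<open>Y ** M ** X\<close> inherits both
  properties.\<close>

lemma mp_inverse_exists: "\<exists>W. is_mp_inverse (M :: complex^'n^'m) W"
proof -
  obtain X where X: "M ** X ** M = M" "conj_transpose (M ** X) = M ** X"
    using least_squares_inverse_exists by blast
  obtain Z where Z: "conj_transpose M ** Z ** conj_transpose M = conj_transpose M"
    "conj_transpose (conj_transpose M ** Z) = conj_transpose M ** Z"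
    using least_squares_inverse_exists by blast
  define Y where "Y = conj_transpose Z"
  have Y: "M ** Y ** M = M" "conj_transpose (Y ** M) = Y ** M"
    using arg_cong[OF Z(1), of conj_transpose] Z(2)
    by (simp_all add: Y_def conj_transpose_mul matrix_mul_assoc)
  have MW: "M ** (Y ** M ** X) = M ** X" and WM: "(Y ** M ** X) ** M = Y ** M"
    using X(1) Y(1) by (simp_all add: matrix_mul_assoc) (metis matrix_mul_assoc)
  have "is_mp_inverse M (Y ** M ** X)"
    unfolding is_mp_inverse_def MW WM using X Y
    by simp (metis matrix_mul_assoc)
  then show ?thesis ..
qed

lemma mp_inverse_unique:
  assumes "is_mp_inverse M X" and "is_mp_inverse M Y"
  shows "X = Y"
proof -
  have X: "M ** X ** M = M" "X ** M ** X = X"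
      "conj_transpose (M ** X) = M ** X" "conj_transpose (X ** M) = X ** M"
    and Y: "M ** Y ** M = M" "Y ** M ** Y = Y"
      "conj_transpose (M ** Y) = M ** Y" "conj_transpose (Y ** M) = Y ** M"
    using assms by (auto simp: is_mp_inverse_def)
  \<comment> \<open>Taking adjoints reverses the order of two Hermitian factors, so the product
    collapses once to \<open>M ** X\<close> and once to \<open>M ** Y\<close>.\<close>
  have "M ** X = conj_transpose ((M ** Y) ** (M ** X))"
    using X(3) Y(1) by (simp add: matrix_mul_assoc)
  also have "\<dots> = (M ** X) ** (M ** Y)"
    by (simp only: conj_transpose_mul[of "M ** Y"] X(3) Y(3))
  also have "\<dots> = M ** Y"
    using X(1) by (simp add: matrix_mul_assoc)
  finally have MX: "M ** X = M ** Y" .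
  have "X ** M = conj_transpose ((X ** M) ** (Y ** M))"
    using X(4) Y(1) by (metis matrix_mul_assoc)
  also have "\<dots> = (Y ** M) ** (X ** M)"
    by (simp only: conj_transpose_mul[of "X ** M"] X(4) Y(4))
  also have "\<dots> = Y ** M"
    using X(1) by (metis matrix_mul_assoc)
  finally have XM: "X ** M = Y ** M" .
  \<comment> \<open>\<open>X = X ** M ** X = X ** M ** Y = Y ** M ** Y = Y\<close>.\<close>
  show ?thesis
    using MX XM X(2) Y(2) by (metis matrix_mul_assoc)
qed

lemma is_mp_inverse_mp_inverse: "is_mp_inverse M (mp_inverse M)"
  unfolding mp_inverse_def
  using mp_inverse_exists mp_inverse_unique by (metis theI)

lemma range_proj_mult: "range_proj M ** M = M"
  and mp_inverse_range_proj: "mp_inverse M ** range_proj M = mp_inverse M"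
  and range_proj_hermitian: "conj_transpose (range_proj M) = range_proj M"
  using is_mp_inverse_mp_inverse[of M]
  by (simp_all add: is_mp_inverse_def range_proj_def matrix_mul_assoc)

lemma range_proj_idem: "range_proj M ** range_proj M = range_proj M"
  unfolding range_proj_def[of M]
  using is_mp_inverse_mp_inverse[of M] by (simp add: is_mp_inverse_def matrix_mul_assoc)

section \<open>Orthogonal projections\<close>

lemma norm_diff_proj_left:
  assumes "conj_transpose P = P" and "P ** P = P"
  shows "(norm (M - P ** M))\<^sup>2 = (norm M)\<^sup>2 - (norm (P ** M))\<^sup>2"
proof -
  have "M \<bullet> (P ** M) = (P ** M) \<bullet> (P ** M)"
    using assms by (simp add: inner_matrix_mult_left matrix_mul_assoc)
  then show ?thesis
    by (simp add: power2_norm_eq_inner inner_diff_left inner_diff_right inner_commute)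
qed

lemma norm_diff_proj_right:
  assumes "conj_transpose P = P" and "P ** P = P"
  shows "(norm (M - M ** P))\<^sup>2 = (norm M)\<^sup>2 - (norm (M ** P))\<^sup>2"
proof -
  have "P ** conj_transpose M = conj_transpose (M ** P)"
    by (simp add: conj_transpose_mul assms)
  then show ?thesis
    using norm_diff_proj_left[OF assms, of "conj_transpose M"]
    by (simp add: conj_transpose_diff[symmetric] norm_conj_transpose)
qed

lemma norm_proj_eq_trace:
  assumes "conj_transpose P = P" and "P ** P = P"
  shows "(norm P)\<^sup>2 = Re (trace P)"
  using inner_matrix_mult_left[of P "mat 1" P] assms
  by (simp add: power2_norm_eq_inner inner_mat_1)

text \<open>Pythagoras leaves the squared norms of \<open>Q\<close> and \<open>Q ** P\<close>, which
  are the trace of \<open>Q\<close> and \<open>Q \<bullet> P\<close>. As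
  \<open>Q \<bullet> P\<close> is symmetric, exchanging the projections affects only the
  trace.\<close>

lemma norm_diff_proj_proj:
  assumes P: "conj_transpose P = P" "P ** P = P" and Q: "conj_transpose Q = Q" "Q ** Q = Q"
  shows "(norm (Q - Q ** P))\<^sup>2 = Re (trace Q) - Q \<bullet> P"
proof -
  have "(Q ** P) \<bullet> (Q ** P) = P \<bullet> (Q ** P)"
    using Q by (simp add: inner_matrix_mult_left matrix_mul_assoc)
  also have "\<dots> = P \<bullet> Q"
    using P inner_matrix_mult_right[of P P Q] by simp
  finally show ?thesis
    using norm_diff_proj_right[OF P, of Q] norm_proj_eq_trace[OF Q]
    by (simp add: power2_norm_eq_inner inner_commute)
qed

lemma norm_proj_diff:
  assumes P: "conj_transpose P = P" "P ** P = P" and Q: "conj_transpose Q = Q" "Q ** Q = Q"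
  shows "(norm (Q - P))\<^sup>2 = (norm (Q - Q ** P))\<^sup>2 + (norm (P - P ** Q))\<^sup>2"
  using norm_diff_proj_proj[OF P Q] norm_diff_proj_proj[OF Q P]
    norm_proj_eq_trace[OF P] norm_proj_eq_trace[OF Q]
  by (simp add: power2_norm_eq_inner inner_diff_left inner_diff_right inner_commute)

section \<open>Trace and rank\<close>

text \<open>An isomorphism between the two ranges and its inverse, written as matrices
  \<open>U\<close> and \<open>V\<close>, carry one idempotent to the other; cyclicity of the trace
  then gives equality.\<close>

lemma trace_idempotent_eq:
  fixes P Q :: "'a::field^'n^'n"
  assumes P: "P ** P = P" and Q: "Q ** Q = Q"
    and dim: "vec.dim (range ((*v) P)) = vec.dim (range ((*v) Q))"
  shows "trace P = trace Q"
proof -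
  have sub: "vec.subspace (range ((*v) R))" for R :: "'a^'n^'n"
    by (simp add: vec.subspace_image vec.subspace_UNIV)
  obtain f where f: "Vector_Spaces.linear (*s) (*s) f" "f ` range ((*v) P) = range ((*v) Q)"
      "inj_on f (range ((*v) P))"
    using vec.subspace_isomorphism[OF sub sub dim] by blast
  \<comment> \<open>\<open>g\<close> is defined on the whole space but takes values in the range of
    \<open>P\<close>; this is what gives \<open>P ** V = V\<close>.\<close>
  obtain g where g: "range g \<subseteq> range ((*v) P)" "Vector_Spaces.linear (*s) (*s) g"
      "\<forall>v\<in>range ((*v) P). g (f v) = v"
    using vec.linear_exists_left_inverse_on[OF f(1) sub f(3)] by blast
  define U V where "U = matrix f" and "V = matrix g"
  have U: "U *v x = f x" and V: "V *v x = g x" for x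
    unfolding U_def V_def using f(1) g(2) by (simp_all add: matrix_works)
  have fixP: "P *v v = v" if "v \<in> range ((*v) P)" for v
    using that P by (auto simp: matrix_vector_mul_assoc)
  have fixQ: "Q *v v = v" if "v \<in> range ((*v) Q)" for v
    using that Q by (auto simp: matrix_vector_mul_assoc)
  have VUP: "V ** U ** P = P"
    using g(3) by (simp add: matrix_eq matrix_vector_mul_assoc[symmetric] U V)
  have PV: "P ** V = V"
    unfolding matrix_eq matrix_vector_mul_assoc[symmetric] V using g(1) fixP by blast
  have QUP: "Q ** (U ** P) = U ** P"
    unfolding matrix_eq matrix_vector_mul_assoc[symmetric] U using f(2) fixQ by blast
  have UVQ: "U ** V ** Q = Q"
  proof -
    have "f (g w) = w" if w: "w \<in> range ((*v) Q)" for w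
    proof -
      obtain v where "v \<in> range ((*v) P)" "w = f v"
        using w f(2) by blast
      then show ?thesis
        using g(3) by metis
    qed
    then show ?thesis
      by (simp add: matrix_eq matrix_vector_mul_assoc[symmetric] U V)
  qed
  have "trace P = trace (V ** (U ** P))"
    using VUP by (simp add: matrix_mul_assoc)
  also have "\<dots> = trace (Q ** (U ** P ** V))"
    using QUP by (subst trace_mul_sym) (simp add: matrix_mul_assoc)
  also have "\<dots> = trace (U ** (P ** V) ** Q)"
    by (subst trace_mul_sym) (simp add: matrix_mul_assoc)
  also have "\<dots> = trace Q"
    by (simp add: PV UVQ)
  finally show ?thesis .
qed

text \<open>\<^const>\<open>rank\<close> is defined as the row rank, hence the transpose.\<close>

lemma rank_eq_dim_range_transpose:
  fixes M :: "'a::field^'n^'m"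
  shows "rank M = vec.dim (range ((*v) (transpose M)))"
proof -
  have "column i (transpose M) \<in> range ((*v) (transpose M))" for i
    by (metis matrix_vector_mult_axis rangeI)
  then have "vec.span (columns (transpose M)) \<subseteq> range ((*v) (transpose M))"
    by (intro vec.span_minimal vec.subspace_image vec.subspace_UNIV) (auto simp only: columns_def)
  moreover have "range ((*v) (transpose M)) \<subseteq> vec.span (columns (transpose M))"
    using matrix_vector_mult_in_columnspace_gen by blast
  ultimately have "range ((*v) (transpose M)) = vec.span (rows M)"
    by simp
  then show ?thesis
    by (simp add: row_rank_def_gen vec.dim_span)
qed

lemma trace_transpose: "trace (transpose M) = trace M"
  by (simp add: trace_def transpose_def)

text \<open>To match the row rank, the comparison uses the idempotent \<open>R M\<close>, which has
  the range of \<open>transpose M\<close>. By cyclicity its trace is that of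
  \<open>range_proj M\<close>.\<close>

lemma trace_range_proj_eq:
  fixes A B :: "complex^'n^'m"
  assumes "rank A = rank B"
  shows "trace (range_proj A) = trace (range_proj B)"
proof -
  define R where "R = (\<lambda>M :: complex^'n^'m. transpose (mp_inverse M ** M))"
  have pen: "M ** mp_inverse M ** M = M" for M :: "complex^'n^'m"
    using is_mp_inverse_mp_inverse by (auto simp: is_mp_inverse_def)
  have idem: "R M ** R M = R M" for M
    unfolding R_def by (metis matrix_transpose_mul matrix_mul_assoc pen)
  have "R M ** transpose M = transpose M" for M
    unfolding R_def by (metis matrix_transpose_mul matrix_mul_assoc pen)
  moreover have "R M = transpose M ** transpose (mp_inverse M)" for M
    by (simp add: R_def matrix_transpose_mul)
  \<comment> \<open>Each of the two matrices is the other followed by a factor on its right or fixes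
    the other from the left, giving both inclusions.\<close>
  ultimately have "range ((*v) (R M)) = range ((*v) (transpose M))" for M
    by (metis (no_types, lifting) image_subset_iff matrix_vector_mul_assoc rangeI subset_antisym)
  then have "trace (R A) = trace (R B)"
    using trace_idempotent_eq[OF idem idem] assms by (metis rank_eq_dim_range_transpose)
  moreover have "trace (R M) = trace (range_proj M)" for M
    unfolding R_def range_proj_def trace_transpose by (rule trace_mul_sym)
  ultimately show ?thesis by simp
qed

section \<open>The lower bounds\<close>

lemma beta1_le: "beta1 A B \<le> (norm (range_proj B - range_proj B ** range_proj A))\<^sup>2"
proof -
  let ?P = "range_proj A" and ?Q = "range_proj B"
  let ?E = "B - A" and ?E' = "mp_inverse B - mp_inverse A"
  \<comment> \<open>For \<open>y = 0\<close> the quotient is 0 by convention, which is at most the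
    nonnegative \<open>c\<close>.\<close>
  have div_le: "x / y \<le> c" if "x \<le> c * y" "0 \<le> c" "0 \<le> y" for x y c :: real
    using that by (cases "y = 0") (auto simp: divide_le_eq)
  have "?E - ?P ** ?E = (?Q - ?P ** ?Q) ** B"
    by (simp add: matrix_diff_ldistrib matrix_diff_rdistrib range_proj_mult matrix_mul_assoc[symmetric])
  \<comment> \<open>The two matrices are adjoint to each other, so both ratios are compared with the
    same number.\<close>
  moreover have "norm (?Q - ?P ** ?Q) = norm (?Q - ?Q ** ?P)"
    using norm_conj_transpose[of "?Q - ?P ** ?Q"]
    by (simp add: conj_transpose_diff conj_transpose_mul range_proj_hermitian)
  ultimately have 1: "(norm ?E)\<^sup>2 - (norm (?P ** ?E))\<^sup>2 \<le> (norm (?Q - ?Q ** ?P))\<^sup>2 * (spectral_norm B)\<^sup>2"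
    using norm_matrix_mult_le_right[of "?Q - ?P ** ?Q" B]
      norm_diff_proj_left[OF range_proj_hermitian range_proj_idem, of ?E] by metis
  have "?E' - ?E' ** ?P = mp_inverse B ** (?Q - ?Q ** ?P)"
    by (simp add: matrix_diff_ldistrib matrix_diff_rdistrib mp_inverse_range_proj matrix_mul_assoc)
  then have 2: "(norm ?E')\<^sup>2 - (norm (?E' ** ?P))\<^sup>2
      \<le> (norm (?Q - ?Q ** ?P))\<^sup>2 * (spectral_norm (mp_inverse B))\<^sup>2"
    using norm_matrix_mult_le_left[of "mp_inverse B" "?Q - ?Q ** ?P"]
      norm_diff_proj_right[OF range_proj_hermitian range_proj_idem, of ?E'] by metis
  have "?E' ** A ** mp_inverse A = ?E' ** ?P"
    by (simp add: range_proj_def matrix_mul_assoc)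
  then show ?thesis
    unfolding beta1_def Let_def frobenius_norm_eq_norm range_proj_def[of A, symmetric]
    using 1 2 by (auto intro!: max.boundedI div_le)
qed

text \<open>Exchanging \<open>A\<close> and \<open>B\<close> only flips the signs of the two
  differences, which no norm detects.\<close>

lemma beta2_eq_beta1: "beta2 A B = beta1 B A"
proof -
  have "norm (X ** (M - N)) = norm (X ** (N - M))" for X :: "complex^'k^'k" and M N :: "complex^'l^'k"
    by (metis matrix_minus_right minus_diff_eq norm_minus_cancel)
  moreover have "norm ((M - N) ** X ** Y) = norm ((N - M) ** X ** Y)"
    for M N :: "complex^'k^'l" and X :: "complex^'l^'k" and Y :: "complex^'k^'l"
    by (metis matrix_minus_left minus_diff_eq norm_minus_cancel)
  ultimately show ?thesis
    unfolding beta1_def beta2_def Let_def frobenius_norm_eq_norm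
    by (metis norm_minus_commute)
qed

theorem theorem3p5:
  fixes A B :: "complex^'n^'m" and r s :: nat
  assumes "rank A = r" and "r \<ge> 1"
    and "rank B = s" and "s \<ge> 1"
  shows "(frobenius_norm (range_proj B - range_proj A))\<^sup>2 \<ge> beta1 A B + beta2 A B \<and>
         (s = r \<longrightarrow>
           (frobenius_norm (range_proj B - range_proj A))\<^sup>2 \<ge> 2 * max (beta1 A B) (beta2 A B))"
proof -
  let ?P = "range_proj A" and ?Q = "range_proj B"
  have P: "conj_transpose ?P = ?P" "?P ** ?P = ?P" and Q: "conj_transpose ?Q = ?Q" "?Q ** ?Q = ?Q"
    by (simp_all add: range_proj_hermitian range_proj_idem)
  have b1: "beta1 A B \<le> (norm (?Q - ?Q ** ?P))\<^sup>2" and b2: "beta2 A B \<le> (norm (?P - ?P ** ?Q))\<^sup>2"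
    by (simp_all add: beta1_le beta2_eq_beta1)
  \<comment> \<open>Equal ranks give equal traces, so each summand is half of the total and bounds
    both betas.\<close>
  have "(norm (?Q - ?Q ** ?P))\<^sup>2 = (norm (?P - ?P ** ?Q))\<^sup>2" if "s = r"
    using trace_range_proj_eq[of A B] that assms norm_diff_proj_proj[OF P Q] norm_diff_proj_proj[OF Q P]
    by (simp add: inner_commute)
  then show ?thesis
    using b1 b2 norm_proj_diff[OF P Q] unfolding frobenius_norm_eq_norm by auto
qed

end
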